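(* Let $m,n$ be positive integers, let $\gamma=(\gamma_{ij}:i\in[m],j\in[n])$ be a nonnegative vector, and let $\sigma\in[n]^{[m]}$ be random with law $\Pr(\sigma)\propto\prod_{i\in[m]}\gamma_{i,\sigma(i)}$. For each $j\in[n]$ let $0=a_0(j)<\cdots<a_{k_j}(j)=m+1$ be a sequence of integers. Let $I\cup J\cup K$ be a partition of $[n]$, let $t_j\in\{0,\dots,k_j-1\}$ for $j\in K$, and let $$Q=\{a_{t_j}(j)\le|\sigma^{-1}(j)|<a_{t_j+1}(j)\ \ \forall j\in K\},$$ where $\Pr(Q)>0$. Let $Z=|\sigma^{-1}(I\cup J)|$. Then the law of $Z$ conditional on $Q$ is ultra-log-concave; that is, the sequence $$\left\{\Pr(Z=i\mid Q)\Big/\binom{m}{i}\right\}_{i=0}^m$$ is log-concave and has no internal zeros.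
   Context: $[m]=\{1,\dots,m\}$; $[n]^{[m]}$ is the set of functions $[m]\to[n]$. It is assumed that $\prod_i\sum_j\gamma_{ij}>0$, so that $\Pr$ is well defined; the $\sigma(i)$'s are then independent but not necessarily identically distributed. Log-concave means $c_i^2\ge c_{i-1}c_{i+1}$ for $1\le i\le m-1$; no internal zeros means that if $i<j<k$ and $c_i,c_k>0$ then $c_j>0$. *)

theory Defs
  imports "HOL-Probability.Probability"
begin

text \<open>
  The set of functions from \<open>{1..m}\<close> to \<open>{1..n}\<close> is represented by extensional functions,
  so that a function on \<open>{1..m}\<close> has exactly one representative.
\<close>

abbreviation assignments :: "nat \<Rightarrow> nat \<Rightarrow> (nat \<Rightarrow> nat) set" where
  "assignments m n \<equiv> {1..m} \<rightarrow>\<^sub>E {1..n}"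

definition assignment_weight :: "nat \<Rightarrow> (nat \<Rightarrow> nat \<Rightarrow> real) \<Rightarrow> (nat \<Rightarrow> nat) \<Rightarrow> real" where
  "assignment_weight m \<gamma> \<sigma> = (\<Prod>i\<in>{1..m}. \<gamma> i (\<sigma> i))"

text \<open>
  \<open>embed_pmf\<close> is only meaningful if the given density is nonnegative and has total mass 1;
  the lemma \<open>pmf_assignment_pmf\<close> below shows that this is so under the standing assumptions.
\<close>

definition assignment_pmf :: "nat \<Rightarrow> nat \<Rightarrow> (nat \<Rightarrow> nat \<Rightarrow> real) \<Rightarrow> (nat \<Rightarrow> nat) pmf" where
  "assignment_pmf m n \<gamma> = embed_pmf (\<lambda>\<sigma>.
     if \<sigma> \<in> assignments m n
     then assignment_weight m \<gamma> \<sigma> / (\<Sum>\<tau>\<in>assignments m n. assignment_weight m \<gamma> \<tau>)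
     else 0)"

definition fibre_card :: "nat \<Rightarrow> (nat \<Rightarrow> nat) \<Rightarrow> nat set \<Rightarrow> nat" where
  "fibre_card m \<sigma> S = card (\<sigma> -` S \<inter> {1..m})"

definition log_concave_seq :: "nat \<Rightarrow> (nat \<Rightarrow> real) \<Rightarrow> bool" where
  "log_concave_seq m c \<longleftrightarrow> (\<forall>i. 1 \<le> i \<and> i + 1 \<le> m \<longrightarrow> (c i)\<^sup>2 \<ge> c (i - 1) * c (i + 1))"

definition no_internal_zeros :: "nat \<Rightarrow> (nat \<Rightarrow> real) \<Rightarrow> bool" where
  "no_internal_zeros m c \<longleftrightarrow>
     (\<forall>i j k. i < j \<and> j < k \<and> k \<le> m \<and> c i > 0 \<and> c k > 0 \<longrightarrow> c j > 0)"

definition ultra_log_concave :: "nat \<Rightarrow> (nat \<Rightarrow> real) \<Rightarrow> bool" where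
  "ultra_log_concave m c \<longleftrightarrow>
     log_concave_seq m (\<lambda>i. c i / real (m choose i)) \<and>
     no_internal_zeros m (\<lambda>i. c i / real (m choose i))"

lemma sum_assignment_weight:
  "(\<Sum>\<tau>\<in>assignments m n. assignment_weight m \<gamma> \<tau>) = (\<Prod>i\<in>{1..m}. \<Sum>j\<in>{1..n}. \<gamma> i j)"
  unfolding assignment_weight_def by (subst prod_sum_PiE) auto

lemma pmf_assignment_pmf:
  assumes nonneg: "\<And>i j. i \<in> {1..m} \<Longrightarrow> j \<in> {1..n} \<Longrightarrow> \<gamma> i j \<ge> 0"
    and pos: "(\<Prod>i\<in>{1..m}. \<Sum>j\<in>{1..n}. \<gamma> i j) > 0"
  shows "pmf (assignment_pmf m n \<gamma>) \<sigma> =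
    (if \<sigma> \<in> assignments m n
     then assignment_weight m \<gamma> \<sigma> / (\<Sum>\<tau>\<in>assignments m n. assignment_weight m \<gamma> \<tau>)
     else 0)"
proof -
  let ?A = "assignments m n"
  let ?w = "assignment_weight m \<gamma>"
  let ?W = "\<Sum>\<tau>\<in>?A. ?w \<tau>"
  let ?f = "\<lambda>\<sigma>. if \<sigma> \<in> ?A then ?w \<sigma> / ?W else 0"
  have fin: "finite ?A" by (intro finite_PiE) auto
  have W: "?W > 0" using pos by (simp only: sum_assignment_weight)
  have w: "?w \<tau> \<ge> 0" if "\<tau> \<in> ?A" for \<tau>
    unfolding assignment_weight_def using that by (intro prod_nonneg nonneg) auto
  have f: "?f \<tau> \<ge> 0" for \<tau> using w W by simp
  have "(\<integral>\<^sup>+\<tau>. ennreal (?f \<tau>) \<partial>count_space UNIV) = (\<Sum>\<tau>\<in>?A. ennreal (?f \<tau>))"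
    by (rule nn_integral_count_space'[OF fin]) auto
  also have "\<dots> = ennreal (\<Sum>\<tau>\<in>?A. ?f \<tau>)" using f by (intro sum_ennreal)
  also have "(\<Sum>\<tau>\<in>?A. ?f \<tau>) = (\<Sum>\<tau>\<in>?A. ?w \<tau> / ?W)" by (intro sum.cong) auto
  also have "\<dots> = 1" using W by (simp only: sum_divide_distrib[symmetric]) simp
  finally have "(\<integral>\<^sup>+\<tau>. ennreal (?f \<tau>) \<partial>count_space UNIV) = 1" by simp
  with f show ?thesis unfolding assignment_pmf_def by (intro pmf_embed_pmf)
qed

end

theory Submission
  imports Defs "HOL-Combinatorics.Multiset_Permutations"
begin

text \<open>
  The generating polynomial \<open>\<Prod>\<^sub>i \<Sum>\<^sub>j \<gamma>\<^sub>i\<^sub>j x\<^sub>j\<close> is Lorentzian in the sense of Braenden and Huh, and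
  restricting the degree of a variable to an interval preserves this.  To work with strictly
  positive tensors throughout, the indicator of an interval is replaced by the log-concave weight
  \<open>\<epsilon>\<^sup>d\<close>, where \<open>d\<close> is the distance to the interval, and \<open>\<epsilon>\<close> is added to every \<open>\<gamma>\<^sub>i\<^sub>j\<close>.  For a
  positive symmetric tensor, Lorentzian signature of the second-order slices implies an
  Alexandrov-Fenchel inequality for all contractions with positive vectors (the Bochner argument of
  Shenfeld and van Handel).  This is used twice: first over the balls, where it gives Alexandrov's
  inequality for permanents and hence the signature of the slices over the bins; then over the bins.
  Contracting \<open>k\<close> times with the indicator of \<open>I \<union> J\<close> and \<open>m - k\<close> times with that of \<open>K\<close> gives
  \<open>k! (m - k)!\<close> times the weight of \<open>{Z = k} \<inter> Q\<close> in the limit \<open>\<epsilon> \<rightarrow> 0\<close>.  Positive log-concave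
  sequences satisfy \<open>c\<^sub>j \<ge> min c\<^sub>i c\<^sub>k\<close> for \<open>i \<le> j \<le> k\<close>, which passes to the limit and excludes
  internal zeros.
\<close>

subsection \<open>Matrices of Lorentzian signature\<close>

definition bil :: "'a set \<Rightarrow> ('a \<Rightarrow> 'a \<Rightarrow> real) \<Rightarrow> ('a \<Rightarrow> real) \<Rightarrow> ('a \<Rightarrow> real) \<Rightarrow> real" where
  "bil S M x y = (\<Sum>i\<in>S. \<Sum>j\<in>S. x i * y j * M i j)"

text \<open>For a symmetric matrix with positive entries over a finite nonempty \<open>S\<close>,
  this reverse Cauchy-Schwarz inequality says that exactly one eigenvalue is positive. The vector
  \<open>x\<close> may have any signs.\<close>

definition lorentz :: "'a set \<Rightarrow> ('a \<Rightarrow> 'a \<Rightarrow> real) \<Rightarrow> bool" where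
  "lorentz S M \<longleftrightarrow>
     (\<forall>x y. (\<forall>i\<in>S. 0 < y i) \<longrightarrow> bil S M x x * bil S M y y \<le> (bil S M x y)\<^sup>2)"

lemma bil_commute:
  assumes "\<forall>i\<in>S. \<forall>j\<in>S. M i j = M j i"
  shows "bil S M x y = bil S M y x"
  unfolding bil_def
  by (subst sum.swap, intro sum.cong refl) (simp add: assms mult.commute)

lemma bil_add_left: "bil S M (\<lambda>i. x i + c * y i) z = bil S M x z + c * bil S M y z"
  unfolding bil_def by (simp add: algebra_simps sum.distrib sum_distrib_left)

lemma bil_add_right: "bil S M z (\<lambda>i. x i + c * y i) = bil S M z x + c * bil S M z y"
  unfolding bil_def by (simp add: algebra_simps sum.distrib sum_distrib_left)

lemma bil_pos:
  assumes "finite S" "S \<noteq> {}" "\<And>i j. i \<in> S \<Longrightarrow> j \<in> S \<Longrightarrow> 0 < M i j"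
    and "\<And>i. i \<in> S \<Longrightarrow> 0 < x i" "\<And>i. i \<in> S \<Longrightarrow> 0 < y i"
  shows "0 < bil S M x y"
  unfolding bil_def using assms by (intro sum_pos) auto

text \<open>A quadratic in \<open>t\<close> with positive leading coefficient and a nonpositive
  value has a real root. Explicitly, \<open>c\<close> times the value is
  \<open>(t * c - b)\<^sup>2 + a * c - b\<^sup>2\<close>.\<close>

lemma discriminant_nonneg:
  fixes a b c t :: real
  assumes "a - 2 * t * b + t\<^sup>2 * c \<le> 0" "0 < c"
  shows "a * c \<le> b\<^sup>2"
proof -
  have "c * (a - 2 * t * b + t\<^sup>2 * c) \<le> 0"
    using assms by (simp add: mult_nonneg_nonpos)
  moreover have "0 \<le> (t * c - b)\<^sup>2" by simp
  ultimately show ?thesis by (simp add: power2_eq_square algebra_simps)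
qed

lemma bil_diff_self:
  assumes "\<forall>i\<in>S. \<forall>j\<in>S. M i j = M j i"
  shows "bil S M (\<lambda>i. x i + (-t) * y i) (\<lambda>i. x i + (-t) * y i) =
    bil S M x x - 2 * t * bil S M x y + t\<^sup>2 * bil S M y y"
  using bil_commute[OF assms, of x y]
  by (simp only: bil_add_left bil_add_right) (simp add: power2_eq_square algebra_simps)

text \<open>One positive test vector \<open>v\<close> suffices: any \<open>x\<close> can be moved
  along \<open>y\<close> into the hyperplane \<open>M\<close>-orthogonal to \<open>v\<close>, where
  the quadratic in \<open>t\<close> takes a nonpositive value.\<close>

lemma lorentzI_hyperplane:
  assumes S: "finite S" "S \<noteq> {}"
    and M_sym: "\<forall>i\<in>S. \<forall>j\<in>S. M i j = M j i"
    and pos: "\<And>i j. i \<in> S \<Longrightarrow> j \<in> S \<Longrightarrow> 0 < M i j"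
    and v: "\<And>i. i \<in> S \<Longrightarrow> 0 < v i"
    and neg: "\<And>x. bil S M x v = 0 \<Longrightarrow> bil S M x x \<le> 0"
  shows "lorentz S M"
  unfolding lorentz_def
proof (intro allI impI)
  fix x y :: "'a \<Rightarrow> real" assume y: "\<forall>i\<in>S. 0 < y i"
  have yv: "0 < bil S M y v" and yy: "0 < bil S M y y"
    using y v by (auto intro!: bil_pos S pos)
  define t where "t = bil S M x v / bil S M y v"
  have "bil S M (\<lambda>i. x i + (-t) * y i) v = 0"
    using yv by (simp only: bil_add_left) (simp add: t_def)
  from neg[OF this] have "bil S M x x - 2 * t * bil S M x y + t\<^sup>2 * bil S M y y \<le> 0"
    unfolding bil_diff_self[OF M_sym] .
  then show "bil S M x x * bil S M y y \<le> (bil S M x y)\<^sup>2"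
    by (rule discriminant_nonneg) (rule yy)
qed

text \<open>The forms ignore coordinates outside \<open>S\<close>; pinning these to 0 gives a box
  that is compact in the product topology over the whole index type.\<close>

lemma compact_box_fun:
  fixes r :: real
  shows "compact {x :: 'a \<Rightarrow> real. \<forall>i. \<bar>x i\<bar> \<le> (if i \<in> S then r else 0)}"
proof -
  have "compactin (product_topology (\<lambda>i::'a. euclidean :: real topology) UNIV)
      (PiE UNIV (\<lambda>i. {-(if i \<in> S then r else 0)..(if i \<in> S then r else 0)}))"
    by (subst compactin_PiE) auto
  moreover have "PiE UNIV (\<lambda>i. {-(if i \<in> S then r else 0)..(if i \<in> S then r else 0)}) =
      {x :: 'a \<Rightarrow> real. \<forall>i. \<bar>x i\<bar> \<le> (if i \<in> S then r else 0)}"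
    by (auto simp: PiE_def Pi_def abs_le_iff split: if_splits)
  ultimately show ?thesis by (simp add: euclidean_product_topology)
qed

lemma continuous_on_bil:
  "continuous_on A (\<lambda>x. bil S M x x)" "continuous_on A (\<lambda>x. bil S M x v)"
  unfolding bil_def
  by (intro continuous_on_sum continuous_on_mult continuous_on_const
    continuous_on_subset[OF continuous_on_product_coordinates] subset_UNIV)+

text \<open>The first-order condition at a maximum.\<close>

lemma linear_le_square_imp_nonpos:
  fixes a b :: real
  assumes "\<And>t. t * a \<le> t\<^sup>2 * b"
  shows "a \<le> 0"
proof (rule ccontr)
  assume a: "\<not> a \<le> 0"
  \<comment> \<open>Makes \<open>t * (\<bar>b\<bar> + 1)\<close> equal to \<open>a / 2\<close>, so
    that the quadratic term cannot compensate the linear one.\<close>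
  define t where "t = a / (2 * (\<bar>b\<bar> + 1))"
  have t: "0 < t" using a by (simp add: t_def)
  have "a \<le> t * b"
    using assms[of t] t by (simp add: power2_eq_square)
  also have "\<dots> \<le> t * (\<bar>b\<bar> + 1)" using t by (intro mult_left_mono) auto
  also have "\<dots> = a / 2" by (simp add: t_def field_simps)
  finally show False using a by simp
qed

text \<open>With \<open>z = x / v\<close>, the difference of the two sides of \<open>le\<close> is
  half the Dirichlet form with positive weights \<open>M i j * v i * v j\<close>. If it vanishes,
  then \<open>z\<close> is constant, so \<open>x\<close> is a multiple of \<open>v\<close>, and
  orthogonality to \<open>v\<close> leaves only 0.\<close>

lemma perron_gap:
  assumes S: "finite S" "S \<noteq> {}"
    and M_sym: "\<forall>i\<in>S. \<forall>j\<in>S. M i j = M j i"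
    and pos: "\<And>i j. i \<in> S \<Longrightarrow> j \<in> S \<Longrightarrow> 0 < M i j"
    and v: "\<And>i. i \<in> S \<Longrightarrow> 0 < v i"
    and p: "\<And>i. i \<in> S \<Longrightarrow> p i * v i = (\<Sum>j\<in>S. M i j * v j)"
    and orth: "bil S M x v = 0"
    and le: "(\<Sum>i\<in>S. p i * (x i)\<^sup>2) \<le> bil S M x x"
    and i: "i \<in> S"
  shows "x i = 0"
proof -
  define z where "z = (\<lambda>i. x i / v i)"
  have x: "x i = z i * v i" if "i \<in> S" for i using v[OF that] by (simp add: z_def)
  define F where "F = (\<lambda>i j. M i j * v i * v j * (z i - z j)\<^sup>2)"
  have F0: "0 \<le> F i j" if "i \<in> S" "j \<in> S" for i j
    unfolding F_def using that v pos by (intro mult_nonneg_nonneg zero_le_power2) (auto intro: less_imp_le)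
  have e1: "(\<Sum>i\<in>S. \<Sum>j\<in>S. M i j * v i * v j * (z i)\<^sup>2) = (\<Sum>i\<in>S. p i * (x i)\<^sup>2)"
  proof (rule sum.cong[OF refl])
    fix i assume i: "i \<in> S"
    have "(\<Sum>j\<in>S. M i j * v i * v j * (z i)\<^sup>2) = (\<Sum>j\<in>S. M i j * v j) * v i * (z i)\<^sup>2"
      by (simp add: sum_distrib_left sum_distrib_right mult_ac)
    then show "(\<Sum>j\<in>S. M i j * v i * v j * (z i)\<^sup>2) = p i * (x i)\<^sup>2"
      using p[OF i] x[OF i] by (simp add: power2_eq_square mult_ac)
  qed
  have e2: "(\<Sum>i\<in>S. \<Sum>j\<in>S. M i j * v i * v j * (z j)\<^sup>2) = (\<Sum>i\<in>S. p i * (x i)\<^sup>2)"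
    unfolding e1[symmetric] by (subst sum.swap, intro sum.cong refl) (simp add: M_sym mult_ac)
  have e3: "bil S M x x = (\<Sum>i\<in>S. \<Sum>j\<in>S. M i j * v i * v j * (z i * z j))"
    unfolding bil_def by (intro sum.cong refl) (simp add: x mult_ac)
  have "(\<Sum>i\<in>S. \<Sum>j\<in>S. F i j) = (\<Sum>i\<in>S. \<Sum>j\<in>S. M i j * v i * v j * (z i)\<^sup>2) +
      (\<Sum>i\<in>S. \<Sum>j\<in>S. M i j * v i * v j * (z j)\<^sup>2) -
      2 * (\<Sum>i\<in>S. \<Sum>j\<in>S. M i j * v i * v j * (z i * z j))"
    unfolding F_def
    by (simp add: power2_diff algebra_simps sum.distrib sum_subtractf sum_distrib_left)
  also have "\<dots> = 2 * ((\<Sum>i\<in>S. p i * (x i)\<^sup>2) - bil S M x x)"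
    unfolding e1 e2 e3 by simp
  finally have "(\<Sum>i\<in>S. \<Sum>j\<in>S. F i j) \<le> 0" using le by simp
  moreover have nn: "0 \<le> (\<Sum>j\<in>S. F i j)" if "i \<in> S" for i
    using F0 that by (intro sum_nonneg) auto
  ultimately have "(\<Sum>i\<in>S. \<Sum>j\<in>S. F i j) = 0" 
    by (meson antisym sum_nonneg)
  then have "\<forall>j\<in>S. (\<Sum>k\<in>S. F j k) = 0"
    using nn by (subst (asm) sum_nonneg_eq_0_iff) (auto simp: S)
  then have "(\<Sum>k\<in>S. F i k) = 0" using i by blast
  then have "\<forall>k\<in>S. F i k = 0"
    using F0 i by (subst (asm) sum_nonneg_eq_0_iff) (auto simp: S)
  moreover have "M i k * v i * v k \<noteq> 0" if "k \<in> S" for k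
    using v[OF i] v[OF that] pos[OF i that] by simp
  ultimately have z: "z k = z i" if "k \<in> S" for k using that by (fastforce simp: F_def)
  have "bil S M x v = z i * bil S M v v"
    unfolding bil_def sum_distrib_left using x z by (intro sum.cong refl) (simp add: mult_ac)
  moreover have "0 < bil S M v v" by (intro bil_pos S pos v)
  ultimately have "z i = 0" using orth by simp
  then show ?thesis using x[OF i] by simp
qed

text \<open>The operator \<open>x \<mapsto> D\<inverse> M x\<close>, where \<open>D\<close> is the diagonal matrix with \<open>D v = M v\<close>, is
  self-adjoint for \<open>D\<close> and has simple top eigenvalue 1 with eigenvector \<open>v\<close>.  The
  hypothesis \<open>bochner\<close> says that every eigenvalue satisfies \<open>\<lambda>\<^sup>2 \<ge> \<lambda>\<close>, so that the others
  are nonpositive.\<close>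

lemma lorentz_bochner:
  assumes S: "finite S" "S \<noteq> {}"
    and M_sym: "\<forall>i\<in>S. \<forall>j\<in>S. M i j = M j i"
    and pos: "\<And>i j. i \<in> S \<Longrightarrow> j \<in> S \<Longrightarrow> 0 < M i j"
    and v: "\<And>i. i \<in> S \<Longrightarrow> 0 < v i"
    and bochner: "\<And>x. bil S M x x \<le>
      (\<Sum>i\<in>S. v i * ((\<Sum>j\<in>S. M i j * x j)\<^sup>2 / (\<Sum>j\<in>S. M i j * v j)))"
  shows "lorentz S M"
proof (rule lorentzI_hyperplane[OF S M_sym pos v])
  define p where "p = (\<lambda>i. (\<Sum>j\<in>S. M i j * v j) / v i)"
  have Mv: "0 < (\<Sum>j\<in>S. M i j * v j)" if "i \<in> S" for i
    using that by (intro sum_pos S mult_pos_pos pos v)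
  have p: "p i * v i = (\<Sum>j\<in>S. M i j * v j)" if "i \<in> S" for i
    using v[OF that] by (simp add: p_def)
  have p0: "0 < p i" if "i \<in> S" for i using Mv v that by (simp add: p_def)
  have p0': "0 \<le> p i" if "i \<in> S" for i using p0[OF that] by simp
  \<comment> \<open>The squared norm belonging to \<open>D\<close>; the maximal Rayleigh quotient of
    \<open>M\<close> against it on the hyperplane is studied below.\<close>
  define N where "N = (\<lambda>x. \<Sum>i\<in>S. p i * (x i)\<^sup>2)"
  have N_eq: "N x = (\<Sum>i\<in>S. p i * (x i)\<^sup>2)" for x by (simp add: N_def)
  have bilM: "bil S M x y = (\<Sum>i\<in>S. y i * (\<Sum>j\<in>S. M i j * x j))" for x y
    by (subst bil_commute[OF M_sym]) (simp add: bil_def sum_distrib_left mult_ac)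
  have N0: "0 \<le> N x" for x
    unfolding N_def by (intro sum_nonneg mult_nonneg_nonneg) (auto simp: p0')
  have N_eq0: "bil S M x y = 0" if "N x = 0" for x y
  proof -
    have "\<forall>i\<in>S. p i * (x i)\<^sup>2 = 0"
      using that p0' unfolding N_def by (subst (asm) sum_nonneg_eq_0_iff) (auto simp: S)
    then have "\<forall>i\<in>S. x i = 0" using p0 by fastforce
    then show ?thesis by (simp add: bil_def)
  qed
  fix x0 assume x0: "bil S M x0 v = 0"
  show "bil S M x0 x0 \<le> 0"
  proof (rule ccontr)
    assume "\<not> bil S M x0 x0 \<le> 0"
    then have x0p: "0 < bil S M x0 x0" by simp
    \<comment> \<open>If \<open>N x = 1\<close>, then each square is at most \<open>1 / p i\<close>.
      The added 1 ensures \<open>r \<le> r\<^sup>2\<close>, so that a bound on the square becomes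
      one on the entry.\<close>
    define r where "r = 1 + (\<Sum>i\<in>S. 1 / p i)"
    define B where "B = {x :: 'a \<Rightarrow> real. \<forall>i. \<bar>x i\<bar> \<le> (if i \<in> S then r else 0)}"
    define C where "C = B \<inter> (N -` {1} \<inter> (\<lambda>x. bil S M x v) -` {0})"
    have "closed (N -` {1})"
      unfolding N_def
      by (intro closed_vimage closed_singleton continuous_on_sum continuous_on_mult
          continuous_on_const continuous_on_power continuous_on_product_coordinates)
    moreover have "closed ((\<lambda>x. bil S M x v) -` {0})"
      by (intro closed_vimage closed_singleton continuous_on_bil)
    ultimately have "compact C"
      unfolding C_def B_def by (intro compact_Int_closed compact_box_fun closed_Int)
    have normalise: "\<exists>y\<in>C. bil S M y y = bil S M x x / N x"
      if "N x \<noteq> 0" "bil S M x v = 0" for x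
    proof -
      define y where "y = (\<lambda>i. if i \<in> S then x i / sqrt (N x) else 0)"
      have Nx: "0 < N x" using that N0[of x] by simp
      have Ny: "N y = 1"
      proof -
        have "N y = (\<Sum>i\<in>S. p i * (x i)\<^sup>2 / N x)"
          using Nx by (subst N_eq, intro sum.cong refl) (simp add: y_def power_divide)
        also have "\<dots> = N x / N x"
          by (simp only: sum_divide_distrib[symmetric] N_eq[of x, symmetric])
        finally have "N y = N x / N x" .
        then show ?thesis using Nx by simp
      qed
      have "bil S M y v = bil S M x v / sqrt (N x)"
        unfolding bil_def sum_divide_distrib by (intro sum.cong refl) (simp add: y_def)
      then have "bil S M y v = 0" using that by simp
      moreover have "bil S M y y = bil S M x x / N x"
        unfolding bil_def sum_divide_distrib
        using Nx by (intro sum.cong refl) (simp add: y_def field_simps)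
      moreover have "y \<in> B"
        unfolding B_def
      proof (intro CollectI allI)
        fix i show "\<bar>y i\<bar> \<le> (if i \<in> S then r else 0)"
        proof (cases "i \<in> S")
          case True
          have "p i * (y i)\<^sup>2 \<le> N y"
            unfolding N_def using True p0' by (intro member_le_sum S) auto
          then have "(y i)\<^sup>2 \<le> 1 / p i" using p0[OF True] Ny by (simp add: field_simps)
          also have "\<dots> \<le> (\<Sum>i\<in>S. 1 / p i)"
            using True p0' by (intro member_le_sum S) auto
          finally have y2: "(y i)\<^sup>2 \<le> r - 1" by (simp add: r_def)
          then have r1: "1 \<le> r" by (smt (verit) zero_le_power2)
          have "(y i)\<^sup>2 \<le> r\<^sup>2"
            using y2 self_le_power[OF r1, of 2] by linarith
          then show ?thesis using True r1 by (simp flip: abs_le_square_iff)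
        qed (simp add: y_def)
      qed
      ultimately show ?thesis using Ny by (auto simp: C_def)
    qed
    have "N x0 \<noteq> 0" using N_eq0[of x0 x0] x0p by auto
    from normalise[OF this x0] obtain y0
      where y0: "y0 \<in> C" "bil S M y0 y0 = bil S M x0 x0 / N x0" by blast
    have y0p: "0 < bil S M y0 y0" using y0 x0p N0[of x0] \<open>N x0 \<noteq> 0\<close> by simp
    \<comment> \<open>This maximiser takes the place of an eigenvector, and its value
      \<open>l\<close> that of the eigenvalue.\<close>
    obtain x where xC: "x \<in> C" and max: "\<And>y. y \<in> C \<Longrightarrow> bil S M y y \<le> bil S M x x"
      using continuous_attains_sup[OF \<open>compact C\<close>, of "\<lambda>x. bil S M x x"] y0(1)
      by (auto intro: continuous_on_bil)
    define l where "l = bil S M x x"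
    have l0: "0 < l" using max[OF y0(1)] y0p by (simp add: l_def)
    have Nx: "N x = 1" and xv: "bil S M x v = 0" using xC by (auto simp: C_def)
    have rayleigh: "bil S M z z \<le> l * N z" if z: "bil S M z v = 0" for z
    proof (cases "N z = 0")
      case False
      then have "0 < N z" using N0[of z] by simp
      moreover obtain u where "u \<in> C" "bil S M u u = bil S M z z / N z"
        using normalise[OF False z] by blast
      ultimately show ?thesis using max[of u] by (simp add: l_def divide_le_eq)
    qed (simp add: N_eq0)
    \<comment> \<open>The image of \<open>x\<close> under the operator; by \<open>yv\<close> below
      it stays in the hyperplane.\<close>
    define y where "y = (\<lambda>i. (\<Sum>j\<in>S. M i j * x j) / p i)"
    have py: "p i * y i = (\<Sum>j\<in>S. M i j * x j)" if "i \<in> S" for i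
      using p0[OF that] by (simp add: y_def)
    have bx: "bil S M x z = (\<Sum>i\<in>S. p i * y i * z i)" for z
      unfolding bilM using py by (intro sum.cong refl) (simp add: mult_ac)
    have bv: "bil S M z v = (\<Sum>i\<in>S. p i * v i * z i)" for z
      by (subst bil_commute[OF M_sym], unfold bilM) (use p in \<open>intro sum.cong refl, simp add: mult_ac\<close>)
    have yv: "bil S M y v = 0"
      unfolding bv using xv unfolding bx by (simp add: mult_ac)
    have xy: "bil S M x y = N y" unfolding bx N_def by (simp add: power2_eq_square mult_ac)
    \<comment> \<open>First variation of the Rayleigh quotient at \<open>x\<close> in direction
      \<open>y\<close>; it yields \<open>N y \<le> l\<^sup>2\<close>.\<close>
    have "t * (2 * (N y - l\<^sup>2)) \<le> t\<^sup>2 * (l * N y - bil S M y y)" for t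
    proof -
      have "bil S M (\<lambda>i. x i + (-(-t)) * y i) v = 0"
        unfolding bil_add_left using xv yv by simp
      from rayleigh[OF this] have "l + 2 * t * N y + t\<^sup>2 * bil S M y y \<le> l * N (\<lambda>i. x i + t * y i)"
        unfolding bil_diff_self[OF M_sym] by (simp add: xy l_def)
      also have "N (\<lambda>i. x i + t * y i) = N x + 2 * t * bil S M x x + t\<^sup>2 * N y"
        unfolding N_def bx
        by (simp add: power2_eq_square algebra_simps sum.distrib sum_distrib_left)
      finally show ?thesis by (simp add: Nx l_def power2_eq_square algebra_simps)
    qed
    then have "2 * (N y - l\<^sup>2) \<le> 0" by (rule linear_le_square_imp_nonpos)
    moreover have "l \<le> N y"
    proof -
      have "l \<le> (\<Sum>i\<in>S. v i * ((\<Sum>j\<in>S. M i j * x j)\<^sup>2 / (\<Sum>j\<in>S. M i j * v j)))"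
        unfolding l_def by (rule bochner)
      also have "\<dots> = N y"
        unfolding N_def
      proof (rule sum.cong[OF refl])
        fix i assume i: "i \<in> S"
        show "v i * ((\<Sum>j\<in>S. M i j * x j)\<^sup>2 / (\<Sum>j\<in>S. M i j * v j)) = p i * (y i)\<^sup>2"
          unfolding py[OF i, symmetric] p[OF i, symmetric]
          using p0[OF i] v[OF i] by (simp add: power2_eq_square field_simps)
      qed
      finally show ?thesis .
    qed
    \<comment> \<open>From \<open>l \<le> N y \<le> l\<^sup>2\<close> and \<open>0 < l\<close>
      follows \<open>1 \<le> l\<close>, which \<open>perron_gap\<close> allows only if
      \<open>x\<close> vanishes on \<open>S\<close>.\<close>
    ultimately have "l * 1 \<le> l * l" by (simp add: power2_eq_square)
    then have "1 \<le> l" using l0 by (simp only: mult_le_cancel_left_pos)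
    then have "(\<Sum>i\<in>S. p i * (x i)\<^sup>2) \<le> bil S M x x" using Nx by (simp add: N_def l_def)
    then have "x i = 0" if "i \<in> S" for i
      using perron_gap[OF S M_sym pos v p xv _ that] by simp
    then have "N x = 0" by (simp add: N_def)
    then show False using Nx by simp
  qed
qed auto

subsection \<open>Contractions of symmetric tensors\<close>

text \<open>The mixed contraction of a symmetric tensor with a list of vectors. Indexing entries by
  multisets makes the tensor symmetric by construction; \<open>w\<close> holds tensors of all
  degrees, and the length of the list selects one.\<close>

fun polar :: "'a set \<Rightarrow> ('a multiset \<Rightarrow> real) \<Rightarrow> ('a \<Rightarrow> real) list \<Rightarrow> real" where
  "polar S w [] = w {#}"
| "polar S w (v # vs) = (\<Sum>i\<in>S. v i * polar S (\<lambda>M. w (add_mset i M)) vs)"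

lemma polar_swap: "polar S w (u # v # vs) = polar S w (v # u # vs)"
  by (simp add: sum_distrib_left, subst sum.swap)
    (simp add: mult_ac add_mset_commute[of _ _ "_ :: 'a multiset"])

lemma polar_bil:
  "polar S w (x # y # vs) = bil S (\<lambda>i j. polar S (\<lambda>M. w (add_mset i (add_mset j M))) vs) x y"
  by (simp add: bil_def sum_distrib_left mult_ac)

lemma polar_move: "polar S w (us @ v # vs) = polar S w (v # us @ vs)"
proof (induction us arbitrary: w)
  case (Cons u us)
  have "polar S w ((u # us) @ v # vs) = polar S w (u # v # us @ vs)"
    using Cons.IH by simp
  then show ?case by (simp only: polar_swap append_Cons)
qed simp

lemma polar_mset_cong:
  assumes "mset us = mset vs"
  shows "polar S w us = polar S w vs"
  using assms
proof (induction us arbitrary: w vs)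
  case (Cons u us)
  then have "u \<in> set vs" by (metis list.set_intros(1) set_mset_mset)
  then obtain as bs where vs: "vs = as @ u # bs" by (meson split_list)
  then have "polar S w (u # us) = polar S w (u # as @ bs)"
    using Cons.IH[of "as @ bs"] Cons.prems by simp
  then show ?case unfolding vs polar_move .
qed simp

lemma polar_pos:
  assumes "finite S" "S \<noteq> {}"
    and "\<And>M. set_mset M \<subseteq> S \<Longrightarrow> 0 < w M"
    and "\<And>v i. v \<in> set vs \<Longrightarrow> i \<in> S \<Longrightarrow> 0 < v i"
  shows "0 < polar S w vs"
  using assms(3,4)
proof (induction vs arbitrary: w)
  case (Cons v vs)
  then show ?case using assms(1,2) by (auto intro!: sum_pos mult_pos_pos)
qed simp

text \<open>Serves to evaluate contractions at \<open>e = 0\<close>. The term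
  \<open>map2 (\<lambda>v. v)\<close> applies each vector to the index at its position.\<close>

lemma polar_expand:
  assumes "finite S"
  shows "polar S w vs = (\<Sum>xs | set xs \<subseteq> S \<and> length xs = length vs.
    prod_list (map2 (\<lambda>v. v) vs xs) * w (mset xs))"
proof (induction vs arbitrary: w)
  case Nil
  have "{xs. set xs \<subseteq> S \<and> length xs = length ([] :: ('a \<Rightarrow> real) list)} = {[]}" by auto
  then show ?case by simp
next
  case (Cons v vs)
  let ?L = "{xs. set xs \<subseteq> S \<and> length xs = length vs}"
  have "(\<Sum>xs | set xs \<subseteq> S \<and> length xs = length (v # vs).
      prod_list (map2 (\<lambda>v. v) (v # vs) xs) * w (mset xs)) =
    (\<Sum>(xs, i)\<in>?L \<times> S. v i * prod_list (map2 (\<lambda>v. v) vs xs) * w (add_mset i (mset xs)))"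
    unfolding length_Cons lists_length_Suc_eq
    by (subst sum.reindex) (auto simp: inj_on_def intro!: sum.cong)
  also have "\<dots> = (\<Sum>i\<in>S. \<Sum>xs\<in>?L. v i * prod_list (map2 (\<lambda>v. v) vs xs) * w (add_mset i (mset xs)))"
    unfolding sum.cartesian_product[symmetric] by (rule sum.swap)
  finally show ?case by (simp add: Cons.IH sum_distrib_left mult.assoc)
qed

text \<open>Induction on the number of contracted vectors. The induction hypothesis is an
  Alexandrov-Fenchel inequality for each slice \<open>w' i\<close>; averaging these inequalities
  with weights \<open>v i\<close> gives exactly the hypothesis of
  \<open>lorentz_bochner\<close>.\<close>

lemma lorentz_polar:
  assumes S: "finite S" "S \<noteq> {}"
    and pos: "\<And>M. set_mset M \<subseteq> S \<Longrightarrow> 0 < w M"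
    and local: "\<And>\<beta>. set_mset \<beta> \<subseteq> S \<Longrightarrow> size \<beta> = length vs \<Longrightarrow>
      lorentz S (\<lambda>i j. w (add_mset i (add_mset j \<beta>)))"
    and vs: "\<And>v i. v \<in> set vs \<Longrightarrow> i \<in> S \<Longrightarrow> 0 < v i"
  shows "lorentz S (\<lambda>i j. polar S (\<lambda>M. w (add_mset i (add_mset j M))) vs)"
  using pos local vs
proof (induction vs arbitrary: w)
  case Nil
  then show ?case by simp
next
  case (Cons v vs)
  define w' where "w' = (\<lambda>i M. w (add_mset i M))"
  let ?M = "\<lambda>i j. polar S (\<lambda>M. w (add_mset i (add_mset j M))) (v # vs)"
  have v: "0 < v i" if "i \<in> S" for i using Cons.prems(3) that by simp
  have row: "(\<Sum>j\<in>S. ?M i j * x j) = polar S (w' i) (x # v # vs)" for i x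
    by (simp add: w'_def mult.commute)
  have Mpos: "0 < ?M i j" if "i \<in> S" "j \<in> S" for i j
    using that Cons.prems by (intro polar_pos S) auto
  show ?case
  proof (rule lorentz_bochner[OF S _ Mpos v])
    show "\<forall>i\<in>S. \<forall>j\<in>S. ?M i j = ?M j i"
      by (simp add: add_mset_commute)
    fix x
    have "bil S ?M x x = polar S w (x # x # v # vs)" by (rule polar_bil[symmetric])
    \<comment> \<open>With \<open>v\<close> in front, its index selects the slice, and both copies
      of \<open>x\<close> are contracted with that slice.\<close>
    also have "\<dots> = polar S w (v # x # x # vs)"
      by (rule polar_mset_cong) simp
    also have "\<dots> = (\<Sum>i\<in>S. v i * polar S (w' i) (x # x # vs))"
      by (simp add: w'_def)
    also have "\<dots> \<le> (\<Sum>i\<in>S. v i * ((polar S (w' i) (x # v # vs))\<^sup>2 / polar S (w' i) (v # v # vs)))"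
    proof (intro sum_mono mult_left_mono)
      fix i assume i: "i \<in> S"
      have "lorentz S (\<lambda>j k. polar S (\<lambda>M. w' i (add_mset j (add_mset k M))) vs)"
      proof (rule Cons.IH)
        fix \<beta> assume "set_mset \<beta> \<subseteq> S" "size \<beta> = length vs"
        then have "lorentz S (\<lambda>j k. w (add_mset j (add_mset k (add_mset i \<beta>))))"
          using i by (intro Cons.prems) auto
        then show "lorentz S (\<lambda>j k. w' i (add_mset j (add_mset k \<beta>)))"
          by (simp add: w'_def add_mset_commute)
      qed (use i Cons.prems in \<open>auto simp: w'_def\<close>)
      then have "polar S (w' i) (x # x # vs) * polar S (w' i) (v # v # vs) \<le>
          (polar S (w' i) (x # v # vs))\<^sup>2"
        unfolding polar_bil lorentz_def using v by blast
      moreover have "0 < polar S (w' i) (v # v # vs)"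
        using i Cons.prems by (intro polar_pos S) (auto simp: w'_def)
      ultimately show "polar S (w' i) (x # x # vs) \<le>
          (polar S (w' i) (x # v # vs))\<^sup>2 / polar S (w' i) (v # v # vs)"
        by (simp add: field_simps)
    qed (use v in \<open>auto intro: less_imp_le\<close>)
    finally show "bil S ?M x x \<le>
        (\<Sum>i\<in>S. v i * ((\<Sum>j\<in>S. ?M i j * x j)\<^sup>2 / (\<Sum>j\<in>S. ?M i j * v j)))"
      unfolding row .
  qed
qed

section \<open>Operations that preserve Lorentzian signature\<close>

text \<open>Lowering the diagonal lowers the quadratic form, so it stays nonpositive on the
  hyperplane orthogonal to \<open>y\<close>; positive entries keep the value at \<open>y\<close>
  positive.\<close>

lemma lorentz_diff_diag:
  assumes S: "finite S" "S \<noteq> {}"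
    and M: "lorentz S M" and M_sym: "\<forall>i\<in>S. \<forall>j\<in>S. M i j = M j i"
    and M': "\<And>i j. i \<in> S \<Longrightarrow> j \<in> S \<Longrightarrow> M' i j = M i j - (if i = j then d i else 0)"
    and pos: "\<And>i j. i \<in> S \<Longrightarrow> j \<in> S \<Longrightarrow> 0 < M' i j"
    and d: "\<And>i. i \<in> S \<Longrightarrow> 0 \<le> d i"
  shows "lorentz S M'"
  unfolding lorentz_def
proof (intro allI impI)
  fix x y :: "'a \<Rightarrow> real" assume y: "\<forall>i\<in>S. 0 < y i"
  have bil': "bil S M' u v = bil S M u v - (\<Sum>i\<in>S. u i * v i * d i)" for u v
  proof -
    have "bil S M' u v = (\<Sum>i\<in>S. (\<Sum>j\<in>S. u i * v j * M i j) -
        (\<Sum>j\<in>S. if i = j then u i * v j * d i else 0))"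
      unfolding bil_def sum_subtractf[symmetric]
      by (intro sum.cong refl) (simp add: M' right_diff_distrib)
    then show ?thesis using S by (simp add: bil_def sum_subtractf)
  qed
  have M'_sym: "\<forall>i\<in>S. \<forall>j\<in>S. M' i j = M' j i" using M_sym by (simp add: M')
  have yy': "0 < bil S M' y y" using y by (intro bil_pos S pos) auto
  also have "\<dots> \<le> bil S M y y"
    unfolding bil' using y d by (auto intro!: sum_nonneg)
  finally have yy: "0 < bil S M y y" .
  \<comment> \<open>The projection is orthogonal for \<open>M\<close>, not for \<open>M'\<close>,
    because the inequality is known for \<open>M\<close>.\<close>
  define t where "t = bil S M x y / bil S M y y"
  let ?z = "\<lambda>i. x i + (-t) * y i"
  have "bil S M ?z y = 0"
    using yy by (simp only: bil_add_left) (simp add: t_def)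
  then have "bil S M ?z ?z * bil S M y y \<le> 0"
    using M y unfolding lorentz_def by (metis power_zero_numeral)
  then have "bil S M ?z ?z \<le> 0" using yy by (simp add: mult_le_0_iff)
  then have "bil S M' ?z ?z \<le> 0"
    unfolding bil' using d by (smt (verit) sum_nonneg mult_nonneg_nonneg zero_le_square)
  then have "bil S M' x x - 2 * t * bil S M' x y + t\<^sup>2 * bil S M' y y \<le> 0"
    unfolding bil_diff_self[OF M'_sym] .
  then show "bil S M' x x * bil S M' y y \<le> (bil S M' x y)\<^sup>2"
    by (rule discriminant_nonneg) (rule yy')
qed

text \<open>A congruence by a positive diagonal matrix maps positive vectors to positive
  vectors.\<close>

lemma lorentz_scale:
  assumes "lorentz S M" "\<And>i. i \<in> S \<Longrightarrow> 0 < r i" "0 < c"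
    and M': "\<And>i j. i \<in> S \<Longrightarrow> j \<in> S \<Longrightarrow> M' i j = c * r i * r j * M i j"
  shows "lorentz S M'"
  unfolding lorentz_def
proof (intro allI impI)
  fix x y :: "'a \<Rightarrow> real" assume y: "\<forall>i\<in>S. 0 < y i"
  have bil': "bil S M' u v = c * bil S M (\<lambda>i. r i * u i) (\<lambda>i. r i * v i)" for u v
    unfolding bil_def sum_distrib_left by (intro sum.cong refl) (simp add: M' mult_ac)
  have "bil S M (\<lambda>i. r i * x i) (\<lambda>i. r i * x i) * bil S M (\<lambda>i. r i * y i) (\<lambda>i. r i * y i) \<le>
      (bil S M (\<lambda>i. r i * x i) (\<lambda>i. r i * y i))\<^sup>2"
    using assms(1,2) y unfolding lorentz_def by simp
  from mult_left_mono[OF this, of "c\<^sup>2"]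
  show "bil S M' x x * bil S M' y y \<le> (bil S M' x y)\<^sup>2"
    unfolding bil' by (simp add: power2_eq_square mult_ac)
qed

lemma lorentz_const: "lorentz S (\<lambda>i j. 1)"
proof -
  have "bil S (\<lambda>i j. 1) x y = (\<Sum>i\<in>S. x i) * (\<Sum>i\<in>S. y i)" for x y
    by (simp add: bil_def sum_product)
  then show ?thesis by (simp add: lorentz_def power2_eq_square mult_ac)
qed

text \<open>Adding \<open>i\<close> and \<open>j\<close> to \<open>\<beta>\<close> multiplies the
  weight by \<open>r i * r j\<close>, with a further factor \<open>q i\<close> if
  \<open>i = j\<close>. Log-concavity gives \<open>q i \<le> 1\<close>, so the new matrix arises by
  lowering the diagonal and then rescaling.\<close>

lemma lorentz_weight:
  fixes A :: "'a multiset \<Rightarrow> real" and g :: "'a \<Rightarrow> nat \<Rightarrow> real"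
  assumes S: "finite S" "S \<noteq> {}"
    and A: "lorentz S (\<lambda>i j. A (add_mset i (add_mset j \<beta>)))"
    and Apos: "\<And>M. set_mset M \<subseteq> S \<Longrightarrow> 0 < A M"
    and gpos: "\<And>i c. i \<in> S \<Longrightarrow> 0 < g i c"
    and logconc: "\<And>i c. i \<in> S \<Longrightarrow> g i c * g i (c + 2) \<le> (g i (c + 1))\<^sup>2"
    and \<beta>: "set_mset \<beta> \<subseteq> S"
  shows "lorentz S (\<lambda>i j. A (add_mset i (add_mset j \<beta>)) *
    (\<Prod>s\<in>S. g s (count (add_mset i (add_mset j \<beta>)) s)))"
proof -
  define N where "N = (\<lambda>i j. A (add_mset i (add_mset j \<beta>)))"
  define c where "c = (\<Prod>s\<in>S. g s (count \<beta> s))"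
  define r where "r = (\<lambda>i. g i (count \<beta> i + 1) / g i (count \<beta> i))"
  define q where "q = (\<lambda>i. g i (count \<beta> i) * g i (count \<beta> i + 2) / (g i (count \<beta> i + 1))\<^sup>2)"
  define d where "d = (\<lambda>i. N i i * (1 - q i))"
  have c: "0 < c" unfolding c_def using gpos by (intro prod_pos) auto
  have r: "0 < r i" if "i \<in> S" for i using that gpos by (simp add: r_def)
  have q: "0 < q i" "q i \<le> 1" if "i \<in> S" for i
  proof -
    have "0 < (g i (count \<beta> i + 1))\<^sup>2" using gpos[OF that] by (rule zero_less_power)
    then show "0 < q i" "q i \<le> 1"
      using logconc[OF that] gpos[OF that] unfolding q_def by simp_all
  qed
  have N: "0 < N i j" if "i \<in> S" "j \<in> S" for i j
    unfolding N_def using that \<beta> by (intro Apos) auto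
  have upd: "(\<Prod>s\<in>S. g s (count (add_mset i M) s)) =
      (\<Prod>s\<in>S. g s (count M s)) * (g i (count M i + 1) / g i (count M i))" if "i \<in> S" for i M
  proof -
    have "(\<Prod>s\<in>S - {i}. g s (count (add_mset i M) s)) = (\<Prod>s\<in>S - {i}. g s (count M s))"
      by (intro prod.cong) auto
    then show ?thesis
      using gpos[OF that, of "count M i"] unfolding prod.remove[OF S(1) that] by simp
  qed
  have "lorentz S (\<lambda>i j. N i j - (if i = j then d i else 0))"
  proof (rule lorentz_diff_diag[OF S, of N _ d])
    show "lorentz S N" unfolding N_def by (rule A)
    show "\<forall>i\<in>S. \<forall>j\<in>S. N i j = N j i" by (simp add: N_def add_mset_commute)
    show "0 \<le> d i" if "i \<in> S" for i
      using q[OF that] N[OF that that] by (simp add: d_def)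
    show "0 < N i j - (if i = j then d i else 0)" if "i \<in> S" "j \<in> S" for i j
    proof (cases "i = j")
      case True
      then have "N i j - (if i = j then d i else 0) = N i j * q i"
        by (simp add: d_def algebra_simps)
      then show ?thesis using N[OF that] q(1)[OF that(1)] by simp
    qed (use N[OF that] in simp)
  qed simp
  then show ?thesis
  proof (rule lorentz_scale[OF _ r c])
    fix i j assume i: "i \<in> S" and j: "j \<in> S"
    have "(\<Prod>s\<in>S. g s (count (add_mset i (add_mset j \<beta>)) s)) =
        c * r j * (g i (count (add_mset j \<beta>) i + 1) / g i (count (add_mset j \<beta>) i))"
      unfolding upd[OF i] upd[OF j] by (simp add: c_def r_def)
    also have "\<dots> = c * r i * r j * (if i = j then q i else 1)"
    proof (cases "i = j")
      case True
      have "g i x \<noteq> 0" for x using gpos[OF i, of x] by simp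
      then show ?thesis using True by (simp add: r_def q_def power2_eq_square)
    qed (simp add: r_def mult_ac)
    finally show "A (add_mset i (add_mset j \<beta>)) *
        (\<Prod>s\<in>S. g s (count (add_mset i (add_mset j \<beta>)) s)) =
        c * r i * r j * (N i j - (if i = j then d i else 0))"
      by (cases "i = j") (simp_all add: N_def d_def algebra_simps)
  qed
qed

subsection \<open>The urn tensor\<close>

text \<open>The form is pulled back along the linear map \<open>C\<close>, which preserves
  positivity of vectors.\<close>

lemma lorentz_congruence:
  assumes T: "finite T" and S: "finite S" "S \<noteq> {}" and N: "lorentz T N"
    and c: "\<And>i b. i \<in> S \<Longrightarrow> b \<in> T \<Longrightarrow> 0 < c i b"
  shows "lorentz S (\<lambda>i j. bil T N (c i) (c j))"
proof -
  define C where "C = (\<lambda>x b. \<Sum>i\<in>S. x i * c i b)"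
  have "bil S (\<lambda>i j. bil T N (c i) (c j)) x y = bil T N (C x) (C y)" for x y
  proof -
    have "bil S (\<lambda>i j. bil T N (c i) (c j)) x y =
        (\<Sum>i\<in>S. \<Sum>j\<in>S. \<Sum>a\<in>T. \<Sum>b\<in>T. (x i * c i a) * (y j * c j b) * N a b)"
      by (simp add: bil_def sum_distrib_left mult_ac)
    also have "\<dots> = (\<Sum>i\<in>S. \<Sum>a\<in>T. \<Sum>b\<in>T. \<Sum>j\<in>S. (x i * c i a) * (y j * c j b) * N a b)"
      by (intro sum.cong refl, subst sum.swap, intro sum.cong refl, rule sum.swap)
    also have "\<dots> = (\<Sum>a\<in>T. \<Sum>b\<in>T. \<Sum>i\<in>S. \<Sum>j\<in>S. (x i * c i a) * (y j * c j b) * N a b)"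
      by (subst sum.swap, intro sum.cong refl, rule sum.swap)
    also have "\<dots> = bil T N (C x) (C y)"
      by (simp add: bil_def C_def flip: sum_product sum_distrib_right)
    finally show ?thesis .
  qed
  moreover have "\<forall>b\<in>T. 0 < C y b" if "\<forall>i\<in>S. 0 < y i" for y
    using that S c by (auto simp: C_def intro!: sum_pos mult_pos_pos)
  ultimately show ?thesis using N unfolding lorentz_def by simp
qed

text \<open>Contractions do not depend on the order of the vectors; sorting merely selects one list
  of columns.\<close>

definition bin_columns :: "('b \<Rightarrow> 'a \<Rightarrow> real) \<Rightarrow> 'a :: linorder multiset \<Rightarrow> ('b \<Rightarrow> real) list" where
  "bin_columns \<gamma> M = map (\<lambda>j b. \<gamma> b j) (sorted_list_of_multiset M)"

text \<open>
  The truncated subtraction makes the exponent vanish exactly if no element is repeated, so that at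
  \<open>e = 0\<close>, where \<open>0 ^ 0 = 1\<close>, only the lists that enumerate the balls contribute.
\<close>

definition ball_weight :: "'b set \<Rightarrow> real \<Rightarrow> 'b multiset \<Rightarrow> real" where
  "ball_weight T e M = (\<Prod>b\<in>T. e ^ (count M b - 1))"

text \<open>At \<open>e = 0\<close> and \<open>size M = card T\<close>, the first factor is the
  permanent of the matrix with columns \<open>bin_columns \<gamma> M\<close>, and the second is the
  indicator that every \<open>h j (count M j)\<close> is 0.\<close>

definition urn_tensor ::
  "'b set \<Rightarrow> 'a :: linorder set \<Rightarrow> ('b \<Rightarrow> 'a \<Rightarrow> real) \<Rightarrow> ('a \<Rightarrow> nat \<Rightarrow> nat) \<Rightarrow> real \<Rightarrow> 'a multiset \<Rightarrow> real" where
  "urn_tensor T S \<gamma> h e M =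
     polar T (ball_weight T e) (bin_columns \<gamma> M) * (\<Prod>j\<in>S. e ^ h j (count M j))"

lemma polar_columns:
  "polar T w (bin_columns \<gamma> (mset xs)) = polar T w (map (\<lambda>j b. \<gamma> b j) xs)"
  unfolding bin_columns_def by (intro polar_mset_cong) (simp add: mset_map del: sorted_list_of_multiset_mset)

lemma polar_columns_add_mset:
  "polar T w (bin_columns \<gamma> (add_mset i (add_mset j M))) =
    polar T w ((\<lambda>b. \<gamma> b i) # (\<lambda>b. \<gamma> b j) # bin_columns \<gamma> M)"
  by (rule polar_mset_cong) (simp add: bin_columns_def)

lemma power_log_concave:
  fixes e :: real
  assumes "0 < e" "e \<le> 1" "2 * h1 \<le> h0 + h2"
  shows "e ^ h0 * e ^ h2 \<le> (e ^ h1)\<^sup>2"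
  using assms by (simp add: power_add[symmetric] power_mult[symmetric] mult.commute power_decreasing)

context
  fixes T :: "'b set" and S :: "'a :: linorder set" and \<gamma> :: "'b \<Rightarrow> 'a \<Rightarrow> real"
    and h :: "'a \<Rightarrow> nat \<Rightarrow> nat" and e :: real
  assumes T: "finite T" "T \<noteq> {}" and S: "finite S" "S \<noteq> {}"
    and \<gamma>: "\<And>b j. b \<in> T \<Longrightarrow> j \<in> S \<Longrightarrow> 0 < \<gamma> b j"
    and h: "\<And>j c. j \<in> S \<Longrightarrow> 2 * h j (c + 1) \<le> h j c + h j (c + 2)"
    and e: "0 < e" "e \<le> 1"
begin

lemma polar_columns_pos: "set_mset M \<subseteq> S \<Longrightarrow> 0 < polar T (ball_weight T e) (bin_columns \<gamma> M)"
  using e \<gamma> by (intro polar_pos T) (auto simp: ball_weight_def bin_columns_def intro!: prod_pos)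

lemma urn_tensor_pos: "set_mset M \<subseteq> S \<Longrightarrow> 0 < urn_tensor T S \<gamma> h e M"
  using e polar_columns_pos unfolding urn_tensor_def by (auto intro!: mult_pos_pos prod_pos)

text \<open>Alexandrov's inequality over the balls comes from \<open>lorentz_polar\<close> with the
  columns of \<open>\<beta>\<close>. Inserting the columns \<open>i\<close> and \<open>j\<close> in
  the two free slots turns it into a statement over the bins, and \<open>lorentz_weight\<close> adds
  the penalties.\<close>

lemma lorentz_urn_tensor:
  assumes \<beta>: "set_mset \<beta> \<subseteq> S"
  shows "lorentz S (\<lambda>i j. urn_tensor T S \<gamma> h e (add_mset i (add_mset j \<beta>)))"
  unfolding urn_tensor_def
proof (rule lorentz_weight[OF S _ _ _ _ \<beta>])
  let ?N = "\<lambda>a b. polar T (\<lambda>M. ball_weight T e (add_mset a (add_mset b M))) (bin_columns \<gamma> \<beta>)"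
  have "lorentz T ?N"
  proof (rule lorentz_polar[OF T])
    fix \<alpha> assume "set_mset \<alpha> \<subseteq> T"
    \<comment> \<open>The all-ones tensor has rank-one slices, and the truncated exponents 0, 0, 1,
      2, ... are convex, so \<open>lorentz_weight\<close> applies.\<close>
    then have "lorentz T (\<lambda>i j. 1 * (\<Prod>s\<in>T. e ^ (count (add_mset i (add_mset j \<alpha>)) s - 1)))"
      using e by (intro lorentz_weight T lorentz_const power_log_concave) auto
    then show "lorentz T (\<lambda>i j. ball_weight T e (add_mset i (add_mset j \<alpha>)))"
      by (simp add: ball_weight_def)
  qed (use e \<gamma> \<beta> in \<open>auto simp: ball_weight_def bin_columns_def intro!: prod_pos\<close>)
  then have "lorentz S (\<lambda>i j. bil T ?N (\<lambda>b. \<gamma> b i) (\<lambda>b. \<gamma> b j))"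
    by (intro lorentz_congruence T S \<gamma>)
  then show "lorentz S (\<lambda>i j. polar T (ball_weight T e) (bin_columns \<gamma> (add_mset i (add_mset j \<beta>))))"
    unfolding polar_columns_add_mset polar_bil .
qed (use e h power_log_concave polar_columns_pos in auto)

text \<open>Three consecutive terms share \<open>k - 1\<close> copies of \<open>u\<close> and
  \<open>m - k - 1\<close> copies of \<open>v\<close>; the two remaining slots hold
  \<open>v v\<close>, \<open>u v\<close> or \<open>u u\<close>.\<close>

lemma polar_urn_log_concave:
  assumes u: "\<And>j. j \<in> S \<Longrightarrow> 0 < u j" and v: "\<And>j. j \<in> S \<Longrightarrow> 0 < v j"
  shows "log_concave_seq m
    (\<lambda>k. polar S (urn_tensor T S \<gamma> h e) (replicate k u @ replicate (m - k) v))"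
  unfolding log_concave_seq_def
proof (intro allI impI)
  fix k assume k: "1 \<le> k \<and> k + 1 \<le> m"
  let ?p = "polar S (urn_tensor T S \<gamma> h e)"
  define k' l' where "k' = k - 1" and "l' = m - k - 1"
  have k': "k = Suc k'" and m: "m = k' + l' + 2" using k by (auto simp: k'_def l'_def)
  define vs where "vs = replicate k' u @ replicate l' v"
  have "lorentz S (\<lambda>i j. polar S (\<lambda>M. urn_tensor T S \<gamma> h e (add_mset i (add_mset j M))) vs)"
    using u v by (intro lorentz_polar S urn_tensor_pos lorentz_urn_tensor) (auto simp: vs_def)
  then have "?p (u # u # vs) * ?p (v # v # vs) \<le> (?p (u # v # vs))\<^sup>2"
    unfolding polar_bil lorentz_def using v by blast
  moreover have "?p (replicate k u @ replicate (m - k) v) = ?p (u # v # vs)"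
    "?p (replicate (k - 1) u @ replicate (m - (k - 1)) v) = ?p (v # v # vs)"
    "?p (replicate (k + 1) u @ replicate (m - (k + 1)) v) = ?p (u # u # vs)"
    by (rule polar_mset_cong; simp add: vs_def k' m Suc_diff_le)+
  ultimately show "?p (replicate (k - 1) u @ replicate (m - (k - 1)) v) *
      ?p (replicate (k + 1) u @ replicate (m - (k + 1)) v) \<le>
      (?p (replicate k u @ replicate (m - k) v))\<^sup>2"
    by (simp only: mult.commute)
qed

end

section \<open>Continuity in \<open>e\<close> and unimodality\<close>

lemma isCont_polar:
  fixes w :: "real \<Rightarrow> 'a multiset \<Rightarrow> real"
  assumes "\<And>M. isCont (\<lambda>e. w e M) a"
    and "\<And>f i. f \<in> set fs \<Longrightarrow> isCont (\<lambda>e. f e i) a"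
  shows "isCont (\<lambda>e. polar S (w e) (map (\<lambda>f. f e) fs)) a"
  using assms
proof (induction fs arbitrary: w)
  case (Cons f fs)
  then show ?case by (auto intro!: continuous_intros)
qed simp

text \<open>All exponents are natural numbers, so the contraction is a polynomial in
  \<open>e\<close>.\<close>

lemma isCont_urn_polar:
  "isCont (\<lambda>e. polar S (urn_tensor T S (\<lambda>b j. \<gamma> b j + e) h e)
     (replicate k (\<lambda>i. u i + e) @ replicate l (\<lambda>i. v i + e))) 0"
proof -
  have "isCont (\<lambda>e. urn_tensor T S (\<lambda>b j. \<gamma> b j + e) h e M) 0" for M
  proof -
    have "isCont (\<lambda>e. polar T (ball_weight T e)
        (map (\<lambda>f. f e) (map (\<lambda>j e b. \<gamma> b j + e) (sorted_list_of_multiset M)))) 0"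
      unfolding ball_weight_def by (intro isCont_polar) (auto intro!: continuous_intros)
    then show ?thesis
      unfolding urn_tensor_def bin_columns_def by (auto simp: o_def intro!: continuous_intros)
  qed
  then have "isCont (\<lambda>e. polar S (urn_tensor T S (\<lambda>b j. \<gamma> b j + e) h e)
     (map (\<lambda>f. f e) (replicate k (\<lambda>e i. u i + e) @ replicate l (\<lambda>e i. v i + e)))) 0"
    by (intro isCont_polar) (auto intro!: continuous_intros)
  then show ?thesis by simp
qed

text \<open>Ratios of consecutive terms do not increase, so a strict descent never ends and the
  sequence cannot rise again after a dip.\<close>

lemma log_concave_seq_min_le:
  assumes pos: "\<And>i. i \<le> m \<Longrightarrow> 0 < c i" and lc: "log_concave_seq m c"
    and "i \<le> j" "j \<le> k" "k \<le> m"
  shows "min (c i) (c k) \<le> c j"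
proof (rule ccontr)
  assume "\<not> min (c i) (c k) \<le> c j"
  then have i: "c j < c i" and k: "c j < c k" by auto
  \<comment> \<open>Since \<open>c j < c i\<close>, some strict descent occurs before
    \<open>j\<close>.\<close>
  have "\<exists>l. i \<le> l \<and> l < j \<and> c (Suc l) < c l"
  proof (rule ccontr)
    assume *: "\<not> ?thesis"
    have "c i \<le> c j"
      using \<open>i \<le> j\<close> by (rule dec_induct) (use * in \<open>auto simp: not_less intro: order_trans\<close>)
    then show False using i by simp
  qed
  then obtain l where l: "l < j" "c (Suc l) < c l" by blast
  have decreasing: "c (Suc q) < c q" if "l \<le> q" "q < m" for q
    using that
  proof (induction q rule: dec_induct)
    case (step q)
    then have "c q * c (q + 2) \<le> (c (q + 1))\<^sup>2"
      using lc[unfolded log_concave_seq_def, rule_format, of "q + 1"] by simp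
    also have "\<dots> < c q * c (q + 1)"
      using step pos[of "q + 1"] by (simp add: power2_eq_square)
    finally show ?case using step pos[of q] by simp
  qed (rule l)
  have "k \<le> m \<longrightarrow> c k \<le> c j"
    using \<open>j \<le> k\<close>
  proof (induction k rule: dec_induct)
    case (step q)
    then show ?case using step.IH assms l(1) decreasing[of q] by auto
  qed simp
  then show False using k assms by simp
qed

section \<open>Value of the contractions at \<open>e = 0\<close>\<close>

lemma count_mset_map_permutation:
  assumes "ys \<in> permutations_of_set T" 
  shows "count (mset (map \<sigma> ys)) j = card {b \<in> T. \<sigma> b = j}"
proof -
  have "count (mset (map \<sigma> ys)) j = length (filter (\<lambda>b. \<sigma> b = j) ys)"
    by (induction ys) auto
  also have "\<dots> = card (set (filter (\<lambda>b. \<sigma> b = j) ys))"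
    using assms by (intro distinct_card[symmetric]) (simp add: permutations_of_set_def)
  finally show ?thesis using assms by (simp add: permutations_of_set_def)
qed

lemma ball_weight_zero:
  assumes "finite T" "set ys \<subseteq> T"
  shows "ball_weight T 0 (mset ys) = of_bool (distinct ys)"
proof (cases "distinct ys")
  case True
  then have "count (mset ys) b \<le> 1" for b by (simp add: distinct_count_atmost_1)
  then show ?thesis using True by (simp add: ball_weight_def)
next
  case False
  then obtain b where "count (mset ys) b > 1"
    unfolding distinct_count_atmost_1
    by (metis count_greater_eq_one_iff less_one linorder_neqE_nat not_in_iff set_mset_mset)
  moreover from this have "b \<in> set ys" by (metis count_greater_zero_iff less_trans set_mset_mset zero_less_one)
  ultimately have "b \<in> T" "(0::real) ^ (count (mset ys) b - 1) = 0"
    using assms(2) by auto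
  then show ?thesis using False assms(1) by (auto simp: ball_weight_def)
qed

lemma distinct_lists_eq_permutations:
  assumes "finite T"
  shows "{ys. (set ys \<subseteq> T \<and> length ys = card T) \<and> distinct ys} = permutations_of_set T"
proof (intro equalityI subsetI)
  fix ys assume "ys \<in> {ys. (set ys \<subseteq> T \<and> length ys = card T) \<and> distinct ys}"
  then have "set ys \<subseteq> T" "card (set ys) = card T" "distinct ys" by (auto simp: distinct_card)
  then show "ys \<in> permutations_of_set T"
    using card_subset_eq[OF assms] by (simp add: permutations_of_set_def)
next
  fix ys assume "ys \<in> permutations_of_set T"
  then show "ys \<in> {ys. (set ys \<subseteq> T \<and> length ys = card T) \<and> distinct ys}"
    using distinct_card[of ys] by (auto simp: permutations_of_set_def)
qed

text \<open>For a fixed enumeration \<open>ys\<close> of the balls, a list of bins is an assignment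
  read along \<open>ys\<close>.\<close>

lemma bij_betw_map_permutation:
  assumes T: "finite T" and S: "finite S" and ys: "ys \<in> permutations_of_set T"
  shows "bij_betw (\<lambda>\<sigma>. map \<sigma> ys) (T \<rightarrow>\<^sub>E S) {xs. set xs \<subseteq> S \<and> length xs = card T}"
proof -
  have set_ys: "set ys = T" and len: "length ys = card T"
    using ys by (auto simp: permutations_of_set_def distinct_card)
  have inj: "inj_on (\<lambda>\<sigma>. map \<sigma> ys) (T \<rightarrow>\<^sub>E S)"
    by (rule inj_onI) (auto simp: set_ys intro: PiE_ext)
  have "(\<lambda>\<sigma>. map \<sigma> ys) ` (T \<rightarrow>\<^sub>E S) = {xs. set xs \<subseteq> S \<and> length xs = card T}"
  \<comment> \<open>Surjectivity by counting: both sets have \<open>card S ^ card T\<close>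
    elements.\<close>
  proof (rule card_subset_eq)
    show "card ((\<lambda>\<sigma>. map \<sigma> ys) ` (T \<rightarrow>\<^sub>E S)) = card {xs. set xs \<subseteq> S \<and> length xs = card T}"
      using T S by (simp add: card_image[OF inj] card_PiE card_lists_length_eq)
  qed (use S in \<open>auto simp: finite_lists_length_eq set_ys len\<close>)
  with inj show ?thesis by (simp add: bij_betw_def)
qed

lemma prod_list_of_bool: "prod_list (map (\<lambda>x. of_bool (P x)) xs) = (of_bool (\<forall>x\<in>set xs. P x) :: real)"
  by (induction xs) auto

lemma prod_list_map2_replicate:
  "length xs = k \<Longrightarrow> prod_list (map2 (\<lambda>v. v) (replicate k u) xs) = prod_list (map u xs)"
  by (induction xs arbitrary: k) auto

text \<open>The two segments exhaust \<open>T\<close>, so they enumerate exactly \<open>X\<close>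
  and \<open>T - X\<close>. This is the source of the factorials.\<close>

lemma card_split_permutations:
  assumes T: "finite T" and X: "X \<subseteq> T" and k: "k \<le> card T"
  shows "card {ys \<in> permutations_of_set T. set (take k ys) \<subseteq> X \<and> set (drop k ys) \<subseteq> T - X} =
    (if card X = k then fact k * fact (card T - k) else 0)" (is "card ?A = _")
proof -
  have len: "length ys = card T" if "ys \<in> ?A" for ys
    using that distinct_card[of ys] by (simp add: permutations_of_set_def)
  have split: "set (take k ys) = X" "set (drop k ys) = T - X" if "ys \<in> ?A" for ys
  proof -
    have "set (take k ys) \<union> set (drop k ys) = T"
      using that by (simp add: permutations_of_set_def flip: set_append)
    then show "set (take k ys) = X" "set (drop k ys) = T - X" using that X by blast+
  qed
  have card_X: "card X = k" if "ys \<in> ?A" for ys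
  proof -
    have "card (set (take k ys)) = k"
      using that len[OF that] k by (subst distinct_card) (auto simp: permutations_of_set_def)
    then show ?thesis using split[OF that] by simp
  qed
  show ?thesis
  proof (cases "card X = k")
    case True
    have len_X: "length as = k" if "as \<in> permutations_of_set X" for as
      using that True by (auto simp: permutations_of_set_def distinct_card)
    have "?A = (\<lambda>(as, bs). as @ bs) ` (permutations_of_set X \<times> permutations_of_set (T - X))"
    proof (intro equalityI subsetI)
      fix ys assume ys: "ys \<in> ?A"
      have "(take k ys, drop k ys) \<in> permutations_of_set X \<times> permutations_of_set (T - X)"
        using split[OF ys] ys by (auto simp: permutations_of_set_def)
      then show "ys \<in> (\<lambda>(as, bs). as @ bs) ` (permutations_of_set X \<times> permutations_of_set (T - X))"
        by (intro image_eqI[of _ _ "(take k ys, drop k ys)"]) auto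
    next
      fix ys assume "ys \<in> (\<lambda>(as, bs). as @ bs) ` (permutations_of_set X \<times> permutations_of_set (T - X))"
      then obtain as bs where ys: "ys = as @ bs"
        and as: "as \<in> permutations_of_set X" and bs: "bs \<in> permutations_of_set (T - X)" by auto
      show "ys \<in> ?A"
        using as bs len_X[OF as] X by (auto simp: ys permutations_of_set_def)
    qed
    moreover have "inj_on (\<lambda>(as, bs). as @ bs) (permutations_of_set X \<times> permutations_of_set (T - X))"
      using len_X by (auto simp: inj_on_def)
    ultimately have "card ?A = fact (card X) * fact (card (T - X))"
      using T X finite_subset[OF X T] by (simp add: card_image card_cartesian_product)
    then show ?thesis
      using True T X finite_subset[OF X T] by (simp add: card_Diff_subset)
  next
    case False
    then have "?A = {}" using card_X by blast
    then show ?thesis using False by (simp only: card.empty if_False)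
  qed
qed

text \<open>The unnormalised probability of \<open>{Z = k} \<inter> Q\<close>, once \<open>U\<close>
  is \<open>I \<union> J\<close> and \<open>h\<close> is the distance to the prescribed
  intervals.\<close>

definition urn_count ::
  "'b set \<Rightarrow> 'a set \<Rightarrow> ('b \<Rightarrow> 'a \<Rightarrow> real) \<Rightarrow> ('a \<Rightarrow> nat \<Rightarrow> nat) \<Rightarrow> 'a set \<Rightarrow> nat \<Rightarrow> real" where
  "urn_count T S \<gamma> h U k =
     (\<Sum>\<sigma> | \<sigma> \<in> T \<rightarrow>\<^sub>E S \<and> card {b \<in> T. \<sigma> b \<in> U} = k \<and> (\<forall>j\<in>S. h j (card {b \<in> T. \<sigma> b = j}) = 0).
       \<Prod>b\<in>T. \<gamma> b (\<sigma> b))"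

text \<open>Expanding over bins and over balls gives a double sum over bin lists \<open>xs\<close>
  and ball permutations \<open>ys\<close>. Each pair encodes an assignment, whose weight does not
  depend on \<open>ys\<close>.\<close>

lemma polar_urn_zero:
  fixes T :: "'b set" and S :: "'a :: linorder set"
  assumes T: "finite T" and S: "finite S" and k: "k \<le> card T"
  shows "polar S (urn_tensor T S \<gamma> h 0)
      (replicate k (\<lambda>j. of_bool (j \<in> U)) @ replicate (card T - k) (\<lambda>j. of_bool (j \<notin> U))) =
    fact k * fact (card T - k) * urn_count T S \<gamma> h U k"
proof -
  define vs :: "('a \<Rightarrow> real) list" where
    "vs = replicate k (\<lambda>j. of_bool (j \<in> U)) @ replicate (card T - k) (\<lambda>j. of_bool (j \<notin> U))"
  have len_vs: "length vs = card T" using k by (simp add: vs_def)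
  define L where "L = {xs. set xs \<subseteq> S \<and> length xs = card T}"
  define G where "G = (\<lambda>M. \<Prod>j\<in>S. (0::real) ^ h j (count M j))"
  define feasible where "feasible = (\<lambda>\<sigma>. \<forall>j\<in>S. h j (card {b \<in> T. \<sigma> b = j}) = 0)"
  \<comment> \<open>The contraction over the balls is a permanent, as repeated balls have weight
    0.\<close>
  have balls: "polar T (ball_weight T 0) (bin_columns \<gamma> (mset xs)) =
      (\<Sum>ys\<in>permutations_of_set T. prod_list (map2 (\<lambda>x y. \<gamma> y x) xs ys))"
    if "length xs = card T" for xs
  proof -
    have "polar T (ball_weight T 0) (bin_columns \<gamma> (mset xs)) =
      (\<Sum>ys | set ys \<subseteq> T \<and> length ys = card T.
        prod_list (map2 (\<lambda>x y. \<gamma> y x) xs ys) * ball_weight T 0 (mset ys))"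
      unfolding polar_columns polar_expand[OF T] using that by (simp add: zip_map1 o_def case_prod_unfold)
    also have "\<dots> = (\<Sum>ys | set ys \<subseteq> T \<and> length ys = card T.
        if distinct ys then prod_list (map2 (\<lambda>x y. \<gamma> y x) xs ys) else 0)"
      using T by (intro sum.cong refl) (simp add: ball_weight_zero)
    also have "\<dots> = (\<Sum>ys\<in>permutations_of_set T. prod_list (map2 (\<lambda>x y. \<gamma> y x) xs ys))"
      unfolding distinct_lists_eq_permutations[OF T, symmetric]
      by (subst sum.inter_filter[symmetric]) (auto simp: finite_lists_length_eq T)
    finally show ?thesis .
  qed
  have "polar S (urn_tensor T S \<gamma> h 0) vs =
      (\<Sum>xs\<in>L. \<Sum>ys\<in>permutations_of_set T.
        prod_list (map2 (\<lambda>v. v) vs xs) * prod_list (map2 (\<lambda>x y. \<gamma> y x) xs ys) * G (mset xs))"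
    unfolding polar_expand[OF S] len_vs L_def[symmetric]
    by (intro sum.cong refl)
      (simp add: L_def urn_tensor_def balls G_def sum_distrib_left sum_distrib_right mult.assoc)
  also have "\<dots> = (\<Sum>ys\<in>permutations_of_set T. \<Sum>xs\<in>L.
        prod_list (map2 (\<lambda>v. v) vs xs) * prod_list (map2 (\<lambda>x y. \<gamma> y x) xs ys) * G (mset xs))"
    by (rule sum.swap)
  \<comment> \<open>Substitute \<open>xs = map \<sigma> ys\<close>. The vectors then test whether
    the first \<open>k\<close> balls fall into \<open>U\<close> and the others do not.\<close>
  also have "\<dots> = (\<Sum>ys\<in>permutations_of_set T. \<Sum>\<sigma>\<in>T \<rightarrow>\<^sub>E S.
        of_bool (set (take k ys) \<subseteq> {b \<in> T. \<sigma> b \<in> U} \<and> set (drop k ys) \<subseteq> T - {b \<in> T. \<sigma> b \<in> U}) *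
        ((\<Prod>b\<in>T. \<gamma> b (\<sigma> b)) * of_bool (feasible \<sigma>)))"
  proof (rule sum.cong[OF refl])
    fix ys assume ys: "ys \<in> permutations_of_set T"
    have set_ys: "set ys = T" and dist: "distinct ys" and len: "length ys = card T"
      using ys by (auto simp: permutations_of_set_def distinct_card)
    have V: "prod_list (map2 (\<lambda>v. v) vs (map \<sigma> ys)) =
        of_bool (set (take k ys) \<subseteq> {b \<in> T. \<sigma> b \<in> U} \<and> set (drop k ys) \<subseteq> T - {b \<in> T. \<sigma> b \<in> U})" for \<sigma>
    proof -
      have "map2 (\<lambda>v. v) vs (map \<sigma> ys) = map2 (\<lambda>v. v) vs (map \<sigma> (take k ys) @ map \<sigma> (drop k ys))"
        by (simp flip: map_append)
      then have "prod_list (map2 (\<lambda>v. v) vs (map \<sigma> ys)) =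
          prod_list (map (\<lambda>b. of_bool (\<sigma> b \<in> U)) (take k ys)) *
          prod_list (map (\<lambda>b. of_bool (\<sigma> b \<notin> U)) (drop k ys))"
        using k len by (simp add: vs_def prod_list_map2_replicate o_def)
      also have "\<dots> = of_bool ((\<forall>b\<in>set (take k ys). \<sigma> b \<in> U) \<and> (\<forall>b\<in>set (drop k ys). \<sigma> b \<notin> U))"
        unfolding prod_list_of_bool by simp
      also have "(\<forall>b\<in>set (take k ys). \<sigma> b \<in> U) \<and> (\<forall>b\<in>set (drop k ys). \<sigma> b \<notin> U) \<longleftrightarrow>
        set (take k ys) \<subseteq> {b \<in> T. \<sigma> b \<in> U} \<and> set (drop k ys) \<subseteq> T - {b \<in> T. \<sigma> b \<in> U}"
        using set_take_subset[of k ys] set_drop_subset[of k ys] by (auto simp: set_ys)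
      finally show ?thesis .
    qed
    have "prod_list (map2 (\<lambda>x y. \<gamma> y x) (map \<sigma> ys) ys) = (\<Prod>b\<in>T. \<gamma> b (\<sigma> b))" for \<sigma>
    proof -
      have "map2 (\<lambda>x y. \<gamma> y x) (map \<sigma> ys) ys = map (\<lambda>b. \<gamma> b (\<sigma> b)) ys"
        by (induction ys) auto
      then show ?thesis
        using prod.distinct_set_conv_list[OF dist, of "\<lambda>b. \<gamma> b (\<sigma> b)"] by (simp add: set_ys)
    qed
    moreover have "G (mset (map \<sigma> ys)) = of_bool (feasible \<sigma>)" for \<sigma>
      unfolding G_def feasible_def count_mset_map_permutation[OF ys] using S
      by (auto simp: power_0_left)
    ultimately show "(\<Sum>xs\<in>L. prod_list (map2 (\<lambda>v. v) vs xs) *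
        prod_list (map2 (\<lambda>x y. \<gamma> y x) xs ys) * G (mset xs)) =
      (\<Sum>\<sigma>\<in>T \<rightarrow>\<^sub>E S.
        of_bool (set (take k ys) \<subseteq> {b \<in> T. \<sigma> b \<in> U} \<and> set (drop k ys) \<subseteq> T - {b \<in> T. \<sigma> b \<in> U}) *
        ((\<Prod>b\<in>T. \<gamma> b (\<sigma> b)) * of_bool (feasible \<sigma>)))"
      unfolding L_def sum.reindex_bij_betw[OF bij_betw_map_permutation[OF T S ys], symmetric]
      by (simp only: V mult.assoc)
  qed
  \<comment> \<open>Only the indicator depends on \<open>ys\<close>, so the inner sum counts
    permutations.\<close>
  also have "\<dots> = (\<Sum>\<sigma>\<in>T \<rightarrow>\<^sub>E S.
      real (card {ys \<in> permutations_of_set T.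
        set (take k ys) \<subseteq> {b \<in> T. \<sigma> b \<in> U} \<and> set (drop k ys) \<subseteq> T - {b \<in> T. \<sigma> b \<in> U}}) *
      ((\<Prod>b\<in>T. \<gamma> b (\<sigma> b)) * of_bool (feasible \<sigma>)))"
    by (subst sum.swap) (simp add: sum_distrib_right[symmetric] sum_of_bool_eq Int_def)
  also have "\<dots> = (\<Sum>\<sigma>\<in>T \<rightarrow>\<^sub>E S. if card {b \<in> T. \<sigma> b \<in> U} = k \<and> feasible \<sigma>
      then fact k * fact (card T - k) * (\<Prod>b\<in>T. \<gamma> b (\<sigma> b)) else 0)"
    using T k by (intro sum.cong refl) (subst card_split_permutations, auto)
  also have "\<dots> = fact k * fact (card T - k) * urn_count T S \<gamma> h U k"
    unfolding urn_count_def feasible_def sum_distrib_left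
    using finite_PiE[OF T, of "\<lambda>_. S"] S by (subst sum.inter_filter[symmetric]) auto
  finally show ?thesis unfolding vs_def .
qed

subsection \<open>Ultra-log-concavity\<close>

text \<open>Since \<open>k! (m - k)!\<close> is \<open>m!\<close> divided by the binomial
  coefficient, log-concavity of \<open>D\<close> is ultra-log-concavity of the counts up to a
  constant.\<close>

lemma urn_count_log_concave:
  fixes T :: "'b set" and S U :: "'a :: linorder set"
  assumes T: "finite T" "T \<noteq> {}" and S: "finite S" "S \<noteq> {}"
    and \<gamma>: "\<And>b j. b \<in> T \<Longrightarrow> j \<in> S \<Longrightarrow> 0 \<le> \<gamma> b j"
    and h: "\<And>j c. j \<in> S \<Longrightarrow> 2 * h j (c + 1) \<le> h j c + h j (c + 2)"
  defines "D \<equiv> \<lambda>k. fact k * fact (card T - k) * urn_count T S \<gamma> h U k"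
  shows "log_concave_seq (card T) D"
    and "i \<le> j \<Longrightarrow> j \<le> k \<Longrightarrow> k \<le> card T \<Longrightarrow> min (D i) (D k) \<le> D j"
proof -
  define m where "m = card T"
  \<comment> \<open>Shifting \<open>\<gamma>\<close> and both indicator vectors by \<open>e\<close>
    makes everything positive for \<open>0 < e\<close>, and \<open>P 0 k\<close> is
    \<open>D k\<close>.\<close>
  define P where "P = (\<lambda>e k. polar S (urn_tensor T S (\<lambda>b j. \<gamma> b j + e) h e)
     (replicate k (\<lambda>j. of_bool (j \<in> U) + e) @ replicate (m - k) (\<lambda>j. of_bool (j \<notin> U) + e)))"
  have lim: "((\<lambda>e. P e k) \<longlongrightarrow> D k) (at_right 0)" if "k \<le> m" for k
  proof -
    have "((\<lambda>e. P e k) \<longlongrightarrow> P 0 k) (at 0)"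
      unfolding P_def by (rule isContD[OF isCont_urn_polar])
    moreover have "P 0 k = D k"
      using polar_urn_zero[OF T(1) S(1), of k \<gamma> h U] that by (simp add: P_def D_def m_def)
    ultimately show ?thesis using tendsto_within_subset by fastforce
  qed
  have small: "\<forall>\<^sub>F e :: real in at_right 0. 0 < e \<and> e \<le> 1"
    unfolding eventually_at_right_field by (intro exI[of _ 1]) auto
  have lc: "log_concave_seq m (P e)" and pos: "0 < P e k" if e: "0 < e \<and> e \<le> 1" for e k
  proof -
    have \<gamma>': "0 < \<gamma> b j + e" if "b \<in> T" "j \<in> S" for b j using \<gamma>[OF that] e by simp
    have "0 < of_bool b + e" for b using e by simp
    then show "log_concave_seq m (P e)"
      unfolding P_def using e by (intro polar_urn_log_concave T S h \<gamma>') auto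
    show "0 < P e k"
      unfolding P_def using e
      by (intro polar_pos S urn_tensor_pos T h \<gamma>') (auto simp: add_pos_nonneg add_nonneg_pos)
  qed
  show "log_concave_seq (card T) D"
    unfolding log_concave_seq_def m_def[symmetric]
  proof (intro allI impI)
    fix k assume k: "1 \<le> k \<and> k + 1 \<le> m"
    have "\<forall>\<^sub>F e in at_right 0. P e (k - 1) * P e (k + 1) \<le> (P e k)\<^sup>2"
      using small by eventually_elim (use lc k in \<open>simp add: log_concave_seq_def\<close>)
    then show "D (k - 1) * D (k + 1) \<le> (D k)\<^sup>2"
      using k by (intro tendsto_le[OF _ tendsto_power[OF lim] tendsto_mult[OF lim lim]]) auto
  qed
  show "min (D i) (D k) \<le> D j" if "i \<le> j" "j \<le> k" "k \<le> card T"
  proof -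
    have "\<forall>\<^sub>F e in at_right 0. min (P e i) (P e k) \<le> P e j"
      using small
    proof eventually_elim
      case (elim e)
      then show ?case
        using that by (intro log_concave_seq_min_le[where m = m] lc pos) (auto simp: m_def)
    qed
    then show ?thesis
      using that by (intro tendsto_le[OF _ lim tendsto_min[OF lim lim]]) (auto simp: m_def)
  qed
qed

section \<open>Intervals and the law of the assignment\<close>

text \<open>If \<open>l < u\<close>, this is the distance of \<open>c\<close> to the half-open
  interval from \<open>l\<close> to \<open>u\<close>; the \<open>+ 1\<close> accounts for the strict
  upper bound. It is convex as a sum of two truncated linear functions.\<close>

definition interval_dist :: "int \<Rightarrow> int \<Rightarrow> nat \<Rightarrow> nat" where
  "interval_dist l u c = nat (l - int c) + nat (int c + 1 - u)"

lemma interval_dist_convex: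
  "2 * interval_dist l u (c + 1) \<le> interval_dist l u c + interval_dist l u (c + 2)"
  by (simp add: interval_dist_def)

lemma interval_dist_eq_0: "interval_dist l u c = 0 \<longleftrightarrow> l \<le> int c \<and> int c < u"
  by (auto simp: interval_dist_def)

lemma prob_assignment_pmf:
  assumes nonneg: "\<And>i j. i \<in> {1..m} \<Longrightarrow> j \<in> {1..n} \<Longrightarrow> \<gamma> i j \<ge> 0"
    and pos: "(\<Prod>i\<in>{1..m}. \<Sum>j\<in>{1..n}. \<gamma> i j) > 0"
  shows "\<P>(\<sigma> in assignment_pmf m n \<gamma>. R \<sigma>) =
    (\<Sum>\<sigma> | \<sigma> \<in> assignments m n \<and> R \<sigma>. assignment_weight m \<gamma> \<sigma>) /
    (\<Prod>i\<in>{1..m}. \<Sum>j\<in>{1..n}. \<gamma> i j)"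
proof -
  let ?p = "assignment_pmf m n \<gamma>"
  have pmf: "pmf ?p \<sigma> = (if \<sigma> \<in> assignments m n
      then assignment_weight m \<gamma> \<sigma> / (\<Prod>i\<in>{1..m}. \<Sum>j\<in>{1..n}. \<gamma> i j) else 0)" for \<sigma>
    unfolding sum_assignment_weight[symmetric] using assms by (rule pmf_assignment_pmf)
  have fin: "finite (assignments m n)" by (intro finite_PiE) auto
  \<comment> \<open>The event ranges over all functions, but the mass function vanishes off
    \<open>assignments m n\<close>.\<close>
  have "\<P>(\<sigma> in ?p. R \<sigma>) = measure_pmf.prob ?p {\<sigma> \<in> assignments m n. R \<sigma>}"
    by (intro measure_eq_AE) (auto simp: AE_measure_pmf_iff set_pmf_eq pmf)
  also have "\<dots> = (\<Sum>\<sigma> | \<sigma> \<in> assignments m n \<and> R \<sigma>. pmf ?p \<sigma>)"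
    using fin by (intro measure_measure_pmf_finite) auto
  also have "\<dots> = (\<Sum>\<sigma> | \<sigma> \<in> assignments m n \<and> R \<sigma>. assignment_weight m \<gamma> \<sigma>) /
      (\<Prod>i\<in>{1..m}. \<Sum>j\<in>{1..n}. \<gamma> i j)"
    by (simp add: pmf sum_divide_distrib)
  finally show ?thesis .
qed

theorem mainTheorem5:
  fixes m n :: nat
    and \<gamma> :: "nat \<Rightarrow> nat \<Rightarrow> real"
    and k :: "nat \<Rightarrow> nat"
    and a :: "nat \<Rightarrow> nat \<Rightarrow> int"
    and I J K :: "nat set"
    and t :: "nat \<Rightarrow> nat"
    and Q :: "(nat \<Rightarrow> nat) \<Rightarrow> bool"
    and Z :: "(nat \<Rightarrow> nat) \<Rightarrow> nat"
  assumes "m > 0" and "n > 0"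
    and "\<And>i j. i \<in> {1..m} \<Longrightarrow> j \<in> {1..n} \<Longrightarrow> \<gamma> i j \<ge> 0"
    and "(\<Prod>i\<in>{1..m}. \<Sum>j\<in>{1..n}. \<gamma> i j) > 0"
    and "\<And>j. j \<in> {1..n} \<Longrightarrow> a j 0 = 0"
    and "\<And>j. j \<in> {1..n} \<Longrightarrow> a j (k j) = int m + 1"
    and "\<And>j. j \<in> {1..n} \<Longrightarrow> strict_mono_on {0..k j} (a j)"
    and "I \<union> J \<union> K = {1..n}"
    and "I \<inter> J = {}" and "I \<inter> K = {}" and "J \<inter> K = {}"
    and "\<And>j. j \<in> K \<Longrightarrow> t j < k j"
    and "\<And>\<sigma>. Q \<sigma> \<longleftrightarrow>
           (\<forall>j\<in>K. a j (t j) \<le> int (fibre_card m \<sigma> {j}) \<and>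
                   int (fibre_card m \<sigma> {j}) < a j (t j + 1))"
    and "\<P>(\<sigma> in assignment_pmf m n \<gamma>. Q \<sigma>) > 0"
    and "\<And>\<sigma>. Z \<sigma> = fibre_card m \<sigma> (I \<union> J)"
  shows "ultra_log_concave m (\<lambda>i. \<P>(\<sigma> in assignment_pmf m n \<gamma>. Z \<sigma> = i \<bar> Q \<sigma>))"
proof -
  note \<gamma> = assms(3) and W = assms(4) and IJK = assms(8) and Q = assms(13) and Z = assms(15)
  \<comment> \<open>The zero penalty leaves the bins in \<open>I \<union> J\<close>
    unconstrained.\<close>
  define h where
    "h = (\<lambda>j c. if j \<in> K then interval_dist (a j (t j)) (a j (t j + 1)) c else 0)"
  let ?W = "\<Prod>i\<in>{1..m}. \<Sum>j\<in>{1..n}. \<gamma> i j"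
  let ?PQ = "\<P>(\<sigma> in assignment_pmf m n \<gamma>. Q \<sigma>)"
  let ?N = "urn_count {1..m} {1..n} \<gamma> h (I \<union> J)"
  let ?D = "\<lambda>i. fact i * fact (m - i) * ?N i"
  let ?c = "\<lambda>i. \<P>(\<sigma> in assignment_pmf m n \<gamma>. Z \<sigma> = i \<bar> Q \<sigma>) / real (m choose i)"
  \<comment> \<open>Collects the total mass, the probability of \<open>Q\<close>, and the
    \<open>m!\<close> of the binomial coefficient, none of which depends on
    \<open>i\<close>.\<close>
  define C where "C = 1 / (?W * ?PQ * fact m)"
  have C: "0 < C" using W assms(14) by (simp add: C_def)
  have fibre: "fibre_card m \<sigma> A = card {b \<in> {1..m}. \<sigma> b \<in> A}" for \<sigma> A
    unfolding fibre_card_def by (rule arg_cong[where f = card]) auto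
  have feasible: "(\<forall>j\<in>{1..n}. h j (card {b \<in> {1..m}. \<sigma> b = j}) = 0) \<longleftrightarrow> Q \<sigma>" for \<sigma>
    unfolding Q fibre using IJK by (auto simp: h_def interval_dist_eq_0)
  have c: "?c i = C * ?D i" if "i \<le> m" for i
  proof -
    have prob: "\<P>(\<sigma> in assignment_pmf m n \<gamma>. Z \<sigma> = i \<and> Q \<sigma>) =
        (\<Sum>\<sigma> | \<sigma> \<in> assignments m n \<and> Z \<sigma> = i \<and> Q \<sigma>. assignment_weight m \<gamma> \<sigma>) / ?W"
      using \<gamma> W by (rule prob_assignment_pmf)
    have "\<P>(\<sigma> in assignment_pmf m n \<gamma>. Z \<sigma> = i \<bar> Q \<sigma>) = ?N i / ?W / ?PQ"
      unfolding cond_prob_def prob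
      by (simp only: urn_count_def feasible Z fibre assignment_weight_def[abs_def])
    then show ?thesis
      using that by (simp add: C_def binomial_fact)
  qed
  have h: "2 * h j (c + 1) \<le> h j c + h j (c + 2)" for j c
    using interval_dist_convex by (simp add: h_def)
  have "{1..m} \<noteq> {}" "{1..n} \<noteq> {}" using assms(1,2) by auto
  \<comment> \<open>The unfolding turns \<open>card {1..m}\<close> into \<open>m\<close>.\<close>
  note lc = urn_count_log_concave[where \<gamma> = \<gamma> and h = h and U = "I \<union> J",
      OF finite_atLeastAtMost this(1) finite_atLeastAtMost this(2) \<gamma> h, unfolded card_atLeastAtMost diff_Suc_1]
  have "log_concave_seq m ?c"
    unfolding log_concave_seq_def
  proof (intro allI impI)
    fix i assume i: "1 \<le> i \<and> i + 1 \<le> m"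
    have "?D (i - 1) * ?D (i + 1) \<le> (?D i)\<^sup>2"
      using lc(1) i unfolding log_concave_seq_def by blast
    from mult_left_mono[OF this, of "C\<^sup>2"]
    have "(C * ?D (i - 1)) * (C * ?D (i + 1)) \<le> (C * ?D i)\<^sup>2"
      by (simp only: power_mult_distrib power2_eq_square mult_ac) simp
    moreover have "?c (i - 1) = C * ?D (i - 1)" "?c (i + 1) = C * ?D (i + 1)" "?c i = C * ?D i"
      by (rule c; use i in linarith)+
    ultimately show "?c (i - 1) * ?c (i + 1) \<le> (?c i)\<^sup>2" by (simp only:)
  qed
  moreover have "no_internal_zeros m ?c"
    unfolding no_internal_zeros_def
  proof (intro allI impI)
    fix i j l assume *: "i < j \<and> j < l \<and> l \<le> m \<and> ?c i > 0 \<and> ?c l > 0"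
    have "0 < C * ?D i" "0 < C * ?D l" using * c[of i] c[of l] by simp_all
    then have "0 < min (?D i) (?D l)" using C by (simp add: zero_less_mult_iff)
    also have "\<dots> \<le> ?D j" using lc(2)[of i j l] * by simp
    finally show "0 < ?c j" using C * by (subst c) (auto intro: mult_pos_pos)
  qed
  ultimately show ?thesis unfolding ultra_log_concave_def by blast
qed

end
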